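(* Let $n\ge1$, $r>1$ and $\sigma_0>0$. For every $x\in\mathbb{R}^n$ and every $s\in\mathbb{Z}$, one has $$\Phi_{s+1}(x)=r^{-n}\,\Phi_s(x/r).$$
   Context: For $\sigma>0$ let $\gamma_\sigma(x)=(2\pi\sigma^2)^{-n/2}\exp(-|x|^2/(2\sigma^2))$ on $\mathbb{R}^n$. For $s\in\mathbb{Z}$ put $\sigma_s=r^s\sigma_0$. The $r$-adic difference-of-Gaussians filters are $\Phi_s=\gamma_{\sigma_s}-\gamma_{\sigma_{s-1}}$, $s\in\mathbb{Z}$. *)

theory Defs
  imports "HOL-Analysis.Analysis"
begin

text \<open>The isotropic Gaussian on \<open>\<real>\<^sup>n\<close>, with \<open>n = CARD('n)\<close>. The norm on \<^typ>\<open>real^'n\<close> is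
  the Euclidean one. Meaningful for \<open>\<sigma> > 0\<close>.\<close>

definition gaussian :: "real \<Rightarrow> real ^ 'n \<Rightarrow> real"
  where "gaussian \<sigma> x =
    (2 * pi * \<sigma>\<^sup>2) powr (- real CARD('n) / 2) * exp (- (norm x)\<^sup>2 / (2 * \<sigma>\<^sup>2))"

definition scale :: "real \<Rightarrow> real \<Rightarrow> int \<Rightarrow> real"
  where "scale r \<sigma>\<^sub>0 s = r powi s * \<sigma>\<^sub>0"

definition DoG :: "real \<Rightarrow> real \<Rightarrow> int \<Rightarrow> real ^ 'n \<Rightarrow> real"
  where "DoG r \<sigma>\<^sub>0 s x = gaussian (scale r \<sigma>\<^sub>0 s) x - gaussian (scale r \<sigma>\<^sub>0 (s - 1)) x"

end

theory Submission
  imports Defs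
begin

text \<open>Widening a Gaussian by the factor r amounts to dilating its argument by 1/r, up to the
  factor r^(-n) that keeps the total mass (\<open>gaussian_dilation\<close>): the exponent depends
  only on |x|/\<sigma>, and the normalising constant is homogeneous of degree -n in \<sigma>.
  Passing from s to s + 1 multiplies both widths in \<open>DoG\<close> by the same r, so the
  identity passes to the difference by linearity.\<close>

lemma gaussian_dilation:
  fixes x :: "real ^ 'n"
  assumes "r > 0" and "\<sigma> > 0"
  shows "gaussian (r * \<sigma>) x = r powi (- int CARD('n)) * gaussian \<sigma> (x /\<^sub>R r)"
proof -
  \<comment> \<open>Writing the square of r as \<open>r powr 2\<close> lets \<open>powr_powr\<close>
    merge the exponents 2 and -n/2 into -n.\<close>
  have "(2 * pi * (r * \<sigma>)\<^sup>2) powr (- real CARD('n) / 2)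
      = (r powr 2 * (2 * pi * \<sigma>\<^sup>2)) powr (- real CARD('n) / 2)"
    using assms by (simp add: power_mult_distrib mult_ac)
  also have "\<dots> = r powr (- real CARD('n)) * (2 * pi * \<sigma>\<^sup>2) powr (- real CARD('n) / 2)"
    using assms by (subst powr_mult) (simp_all only: powr_powr, simp_all)
  \<comment> \<open>The exponent -n is an integer, so the real power becomes the integer power of
    the statement.\<close>
  also have "r powr (- real CARD('n)) = r powi (- int CARD('n))"
    using assms by (simp add: powr_real_of_int' [symmetric])
  finally have const: "(2 * pi * (r * \<sigma>)\<^sup>2) powr (- real CARD('n) / 2)
      = r powi (- int CARD('n)) * (2 * pi * \<sigma>\<^sup>2) powr (- real CARD('n) / 2)" .
  have "- (norm x)\<^sup>2 / (2 * (r * \<sigma>)\<^sup>2) = - (norm (x /\<^sub>R r))\<^sup>2 / (2 * \<sigma>\<^sup>2)"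
    using assms by (simp add: power_mult_distrib field_simps)
  with const show ?thesis
    by (simp only: gaussian_def mult.assoc)
qed

lemma scale_add_1:
  assumes "r \<noteq> 0"
  shows "scale r \<sigma>\<^sub>0 (s + 1) = r * scale r \<sigma>\<^sub>0 s"
  using assms by (simp add: scale_def power_int_add_1')

lemma scale_pos:
  assumes "r > 0" and "\<sigma>\<^sub>0 > 0"
  shows "scale r \<sigma>\<^sub>0 s > 0"
  using assms by (simp add: scale_def)

theorem proposition5p2:
  fixes r \<sigma>\<^sub>0 :: real and x :: "real ^ 'n" and s :: int
  assumes "r > 1" and "\<sigma>\<^sub>0 > 0"
  shows "DoG r \<sigma>\<^sub>0 (s + 1) x = r powi (- int CARD('n)) * DoG r \<sigma>\<^sub>0 s (x /\<^sub>R r)"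
proof -
  have r: "r > 0" "r \<noteq> 0"
    using assms by auto
  \<comment> \<open>The index t stays free because the law is needed at both scales of the
    filter.\<close>
  have shift: "gaussian (scale r \<sigma>\<^sub>0 (t + 1)) x
      = r powi (- int CARD('n)) * gaussian (scale r \<sigma>\<^sub>0 t) (x /\<^sub>R r)" for t
    using gaussian_dilation [OF r(1) scale_pos [OF r(1) assms(2)]]
    by (simp only: scale_add_1 [OF r(2)])
  show ?thesis
    \<comment> \<open>Taking t = s - 1 handles the narrower Gaussian, since (s - 1) + 1 and (s + 1)
      - 1 are both s.\<close>
    using shift [of s] shift [of "s - 1"] by (simp add: DoG_def right_diff_distrib)
qed

end
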